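(* Let $(x^*,X^* )$ be an optimal solution of problem (DNNP) and suppose $X^*=x^*(x^* )^T$. Then $\mathrm{Opt(SOQP)}=\mathrm{Opt(DNNP)}$ and $x^*$ is an optimal solution of problem (SOQP). Furthermore, $x^*$ is a Pareto optimal solution of problem (MOQP) if $\lambda>0$ (that is, $\lambda_i>0$ for all $i$), and $x^*$ is a weakly Pareto optimal solution of problem (MOQP) if $\lambda\ge 0$ (that is, $\lambda_i\ge0$ for all $i$).
   Context: Data: positive integers $n,m,p$; symmetric matrices $Q_1,\dots,Q_p\in\mathbb{R}^{n\times n}$ that are not positive semidefinite; vectors $c_1,\dots,c_p\in\mathbb{R}^n$; a matrix $A\in\mathbb{R}^{m\times n}$ and a vector $b\in\mathbb{R}^m$; weights $\lambda=(\lambda_1,\dots,\lambda_p)$ with $\lambda_i\ge 0$ for all $i$ and $\sum_{i=1}^p\lambda_i=1$. Put $F_i(x)=x^TQ_ix+2c_i^Tx$ and $\Omega=\{x\in\mathbb{R}^n: Ax=b,\ x\ge 0\}$, where $x\ge0$ is componentwise. Problem (MOQP): minimize the vector $F(x)=(F_1(x),\dots,F_p(x))^T$ over $x\in\Omega$. A point $x^*\in\Omega$ is a Pareto optimal solution of (MOQP) if there is no $x\in\Omega$ with $F_i(x)\le F_i(x^* )$ for all $i=1,\dots,p$ and $F_i(x)<F_i(x^* )$ for at least one $i$. It is a weakly Pareto optimal solution of (MOQP) if there is no $x\in\Omega$ with $F_i(x)<F_i(x^* )$ for all $i=1,\dots,p$. Problem (SOQP): minimize $\sum_{i=1}^p\lambda_i(x^TQ_ix+2c_i^Tx)$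 over $x\in\Omega$. Notation: for matrices $M,N$ of the same size, $M\bullet N=\mathrm{trace}(M^TN)$; $\mathrm{diag}(M)$ is the column vector of diagonal entries of $M$; $b\circ b$ is the componentwise product, with $i$-th entry $b_i^2$. $S_k^+$ is the cone of $k\times k$ real symmetric positive semidefinite matrices; $(S_k)^+$ is the cone of $k\times k$ real symmetric matrices with nonnegative entries. Problem (DNNP), in the variables $x\in\mathbb{R}^n$ and $X\in\mathbb{R}^{n\times n}$: minimize $\sum_{i=1}^p\lambda_i(Q_i\bullet X+2c_i^Tx)$ subject to $Ax=b$, $\mathrm{diag}(AXA^T)=b\circ b$, and $\begin{pmatrix} 1 & x^T \\ x & X \end{pmatrix}\in S_{1+n}^+\cap(S_{1+n})^+$. $\mathrm{Opt}(\cdot)$ denotes the optimal objective value of a problem. *)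

theory Defs
  imports "HOL-Analysis.Analysis"
begin

section \<open>Matrices\<close>

definition matrix_inner :: "real^'n^'m \<Rightarrow> real^'n^'m \<Rightarrow> real" (infixl "\<bullet>\<^sub>M" 70)
  where "M \<bullet>\<^sub>M N = trace (transpose M ** N)"

definition diag_vec :: "real^'k^'k \<Rightarrow> real^'k"
  where "diag_vec M = (\<chi> i. M $ i $ i)"

definition outer_product :: "real^'n \<Rightarrow> real^'m \<Rightarrow> real^'m^'n"
  where "outer_product x y = (\<chi> i j. x $ i * y $ j)"

definition symmetric_matrices :: "(real^'k^'k) set"
  where "symmetric_matrices = {M. transpose M = M}"

definition psd_cone :: "(real^'k^'k) set"
  where "psd_cone = {M \<in> symmetric_matrices. \<forall>v. 0 \<le> v \<bullet> (M *v v)}"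

definition nonneg_cone :: "(real^'k^'k) set"
  where "nonneg_cone = {M \<in> symmetric_matrices. \<forall>i j. 0 \<le> M $ i $ j}"

text \<open>The block matrix with rows \<open>(1, x\<^sup>T)\<close> and \<open>(x, X)\<close>; its index type
  \<^typ>\<open>1 + 'n\<close> has \<open>Inl 1\<close> for the leading index and \<open>Inr i\<close> for the others.\<close>

definition bordered_matrix :: "real^'n \<Rightarrow> real^'n^'n \<Rightarrow> real^(1 + 'n)^(1 + 'n)"
  where "bordered_matrix x X =
    (\<chi> r s. case r of
        Inl _ \<Rightarrow> (case s of Inl _ \<Rightarrow> 1 | Inr j \<Rightarrow> x $ j)
      | Inr i \<Rightarrow> (case s of Inl _ \<Rightarrow> x $ i | Inr j \<Rightarrow> X $ i $ j))"

section \<open>Minimization problems\<close>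

text \<open>The optimal value is taken in the extended reals, so that it is also meaningful
  for infeasible and for unbounded problems.\<close>

definition optimal_solution :: "('a \<Rightarrow> real) \<Rightarrow> 'a set \<Rightarrow> 'a \<Rightarrow> bool"
  where "optimal_solution f S x \<longleftrightarrow> is_arg_min f (\<lambda>y. y \<in> S) x"

definition Opt :: "('a \<Rightarrow> real) \<Rightarrow> 'a set \<Rightarrow> ereal"
  where "Opt f S = (INF x\<in>S. ereal (f x))"

definition pareto_optimal :: "('i \<Rightarrow> 'a \<Rightarrow> real) \<Rightarrow> 'a set \<Rightarrow> 'a \<Rightarrow> bool"
  where "pareto_optimal F S z \<longleftrightarrow>
    z \<in> S \<and> \<not> (\<exists>x\<in>S. (\<forall>i. F i x \<le> F i z) \<and> (\<exists>i. F i x < F i z))"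

definition weakly_pareto_optimal :: "('i \<Rightarrow> 'a \<Rightarrow> real) \<Rightarrow> 'a set \<Rightarrow> 'a \<Rightarrow> bool"
  where "weakly_pareto_optimal F S z \<longleftrightarrow>
    z \<in> S \<and> \<not> (\<exists>x\<in>S. \<forall>i. F i x < F i z)"

section \<open>The problems MOQP, SOQP and DNNP\<close>

text \<open>The data are \<open>Q i\<close>, \<open>c i\<close> for \<open>i\<close> in the finite index type \<open>'p\<close>, and \<open>A\<close>, \<open>b\<close>.
  The order on \<^typ>\<open>real^'n\<close> and the product on \<^typ>\<open>real^'m\<close> are componentwise.\<close>

definition MOQP_obj :: "('p \<Rightarrow> real^'n^'n) \<Rightarrow> ('p \<Rightarrow> real^'n) \<Rightarrow> 'p \<Rightarrow> real^'n \<Rightarrow> real"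
  where "MOQP_obj Q c i x = x \<bullet> (Q i *v x) + 2 * (c i \<bullet> x)"

definition QP_feasible :: "real^'n^'m \<Rightarrow> real^'m \<Rightarrow> (real^'n) set"
  where "QP_feasible A b = {x. A *v x = b \<and> 0 \<le> x}"

definition SOQP_obj ::
    "('p::finite \<Rightarrow> real^'n^'n) \<Rightarrow> ('p \<Rightarrow> real^'n) \<Rightarrow> ('p \<Rightarrow> real) \<Rightarrow> real^'n \<Rightarrow> real"
  where "SOQP_obj Q c lam x = (\<Sum>i\<in>UNIV. lam i * (x \<bullet> (Q i *v x) + 2 * (c i \<bullet> x)))"

definition DNNP_obj ::
    "('p::finite \<Rightarrow> real^'n^'n) \<Rightarrow> ('p \<Rightarrow> real^'n) \<Rightarrow> ('p \<Rightarrow> real) \<Rightarrow>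
      (real^'n) \<times> (real^'n^'n) \<Rightarrow> real"
  where "DNNP_obj Q c lam = (\<lambda>(x, X). \<Sum>i\<in>UNIV. lam i * (Q i \<bullet>\<^sub>M X + 2 * (c i \<bullet> x)))"

definition DNNP_feasible :: "real^'n^'m \<Rightarrow> real^'m \<Rightarrow> ((real^'n) \<times> (real^'n^'n)) set"
  where "DNNP_feasible A b =
    {(x, X). A *v x = b \<and> diag_vec (A ** X ** transpose A) = b * b
       \<and> bordered_matrix x X \<in> psd_cone \<inter> nonneg_cone}"

end

theory Submission
  imports Defs
begin

text \<open>
  The problem DNNP is a relaxation of SOQP: sending \<open>y\<close> to \<open>(y, y y\<^sup>T)\<close> maps the feasible set of
  SOQP into that of DNNP and preserves the objective. Indeed the bordered matrix of this pair is
  \<open>w w\<^sup>T\<close> with \<open>w = (1, y)\<close>, hence positive semidefinite, and entrywise nonnegative because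
  \<open>y \<ge> 0\<close>; moreover \<open>A y y\<^sup>T A\<^sup>T = b b\<^sup>T\<close>, and \<open>Q \<bullet> y y\<^sup>T = y\<^sup>T Q y\<close>
  (\<open>lift_feasible\<close>, \<open>DNNP_obj_lift\<close>).
  Conversely the \<open>x\<close>-part of any point feasible for DNNP is feasible for SOQP, since \<open>x\<close> is
  a row of a nonnegative matrix. An optimal solution of the relaxation that is itself a lift
  therefore comes from an optimal solution of SOQP, and the two optimal values agree.

  The statements on Pareto optimality are the usual scalarization argument: a point dominating a
  minimizer of a weighted sum would make that sum strictly smaller. Strict domination in a single
  objective suffices if all weights are positive; for nonnegative weights, one weight is positive
  because they sum to one, and strict domination in every objective is needed.
\<close>

lemma outer_product_mult_vec: "outer_product u v *v w = (v \<bullet> w) *\<^sub>R u"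
  by (simp add: vec_eq_iff outer_product_def matrix_vector_mult_def inner_vec_def
      sum_distrib_left mult_ac)

lemma matrix_inner_outer_product: "M \<bullet>\<^sub>M outer_product u v = u \<bullet> (M *v v)"
proof -
  have "M \<bullet>\<^sub>M outer_product u v = (\<Sum>j\<in>UNIV. \<Sum>i\<in>UNIV. M $ i $ j * (u $ i * v $ j))"
    by (simp add: matrix_inner_def trace_def matrix_matrix_mult_def transpose_def
        outer_product_def)
  also have "\<dots> = (\<Sum>i\<in>UNIV. \<Sum>j\<in>UNIV. M $ i $ j * (u $ i * v $ j))"
    by (rule sum.swap)
  also have "\<dots> = u \<bullet> (M *v v)"
    by (simp add: inner_vec_def matrix_vector_mult_def sum_distrib_left mult_ac)
  finally show ?thesis .
qed

lemma outer_product_congruence: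
  "A ** outer_product u v ** transpose B = outer_product (A *v u) (B *v v)"
proof -
  have "(A ** outer_product u v) = outer_product (A *v u) v"
    by (simp add: vec_eq_iff matrix_matrix_mult_def matrix_vector_mult_def outer_product_def
        sum_distrib_left sum_distrib_right mult_ac)
  moreover have "outer_product w v ** transpose B = outer_product w (B *v v)" for w :: "real^'z"
    by (simp add: vec_eq_iff matrix_matrix_mult_def matrix_vector_mult_def outer_product_def
        transpose_def sum_distrib_left mult_ac)
  ultimately show ?thesis by simp
qed

lemma diag_vec_outer_product: "diag_vec (outer_product u v) = u * v"
  by (simp add: vec_eq_iff diag_vec_def outer_product_def)

lemma outer_product_self_symmetric: "outer_product u u \<in> symmetric_matrices"
  by (simp add: symmetric_matrices_def vec_eq_iff transpose_def outer_product_def mult.commute)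

lemma outer_product_self_psd: "outer_product u u \<in> psd_cone"
  by (simp add: psd_cone_def outer_product_self_symmetric outer_product_mult_vec
      inner_commute)

lemma outer_product_self_nonneg:
  assumes "\<And>i. 0 \<le> u $ i"
  shows "outer_product u u \<in> nonneg_cone"
  using assms by (simp add: nonneg_cone_def outer_product_self_symmetric)
    (simp add: outer_product_def)

text \<open>Bordering \<open>y y\<^sup>T\<close> keeps the rank equal to one, so both cone constraints of DNNP reduce
  to facts about a single vector.\<close>

lemma bordered_outer_product:
  "bordered_matrix y (outer_product y y) =
    outer_product (\<chi> r. case r of Inl _ \<Rightarrow> 1 | Inr i \<Rightarrow> y $ i)
      (\<chi> r. case r of Inl _ \<Rightarrow> 1 | Inr i \<Rightarrow> y $ i)"
  by (simp add: vec_eq_iff bordered_matrix_def outer_product_def split: sum.split)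

lemma lift_feasible:
  assumes "y \<in> QP_feasible A b"
  shows "(y, outer_product y y) \<in> DNNP_feasible A b"
proof -
  from assms have "A *v y = b" and "\<And>i. 0 \<le> y $ i"
    by (auto simp: QP_feasible_def less_eq_vec_def)
  moreover from this have "bordered_matrix y (outer_product y y) \<in> psd_cone \<inter> nonneg_cone"
    unfolding bordered_outer_product
    by (intro IntI outer_product_self_psd outer_product_self_nonneg)
      (simp split: sum.split)
  ultimately show ?thesis
    by (simp add: DNNP_feasible_def outer_product_congruence diag_vec_outer_product)
qed

lemma DNNP_obj_lift: "DNNP_obj Q c lam (y, outer_product y y) = SOQP_obj Q c lam y"
  by (simp add: DNNP_obj_def SOQP_obj_def matrix_inner_outer_product)

text \<open>The constraint \<open>x \<ge> 0\<close>, absent from the formulation of DNNP, is enforced by the border of the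
  entrywise nonnegative matrix.\<close>

lemma DNNP_feasible_fst:
  assumes "(y, Y) \<in> DNNP_feasible A b"
  shows "y \<in> QP_feasible A b"
proof -
  have "bordered_matrix y Y $ Inl 1 $ Inr j = y $ j" for j
    by (simp add: bordered_matrix_def)
  with assms have "0 \<le> y $ j" for j
    unfolding DNNP_feasible_def nonneg_cone_def by (smt (verit) IntD2 case_prodD mem_Collect_eq)
  with assms show ?thesis
    by (simp add: DNNP_feasible_def QP_feasible_def less_eq_vec_def)
qed

lemma optimal_solution_iff:
  "optimal_solution f S x \<longleftrightarrow> x \<in> S \<and> (\<forall>y\<in>S. f x \<le> f y)"
  by (auto simp: optimal_solution_def is_arg_min_def not_less)

lemma Opt_eq_at_optimal_solution:
  assumes "optimal_solution f S x"
  shows "Opt f S = ereal (f x)"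
  unfolding Opt_def
proof (rule antisym)
  show "(INF y\<in>S. ereal (f y)) \<le> ereal (f x)"
    using assms by (intro INF_lower) (simp add: optimal_solution_iff)
  show "ereal (f x) \<le> (INF y\<in>S. ereal (f y))"
    using assms by (intro INF_greatest) (simp add: optimal_solution_iff)
qed

lemma weighted_sum_pareto_optimal:
  fixes F :: "'p::finite \<Rightarrow> 'a \<Rightarrow> real"
  assumes opt: "optimal_solution (\<lambda>y. \<Sum>i\<in>UNIV. lam i * F i y) S x"
    and pos: "\<And>i. 0 < lam i"
  shows "pareto_optimal F S x"
proof -
  have False if y: "y \<in> S" and le: "\<forall>i. F i y \<le> F i x" and less: "F k y < F k x" for y k
  proof -
    have "(\<Sum>i\<in>UNIV. lam i * F i y) < (\<Sum>i\<in>UNIV. lam i * F i x)"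
      by (rule sum_strict_mono_ex1)
        (use le less pos in \<open>auto intro!: mult_left_mono exI[of _ k] simp: less_imp_le\<close>)
    with opt y show False by (auto simp: optimal_solution_iff not_less[symmetric])
  qed
  with opt show ?thesis by (auto simp: pareto_optimal_def optimal_solution_iff)
qed

text \<open>Objectives of weight zero may decrease without affecting the weighted sum, so a dominating point
  contradicts minimality only if it improves an objective of positive weight; strict domination
  everywhere guarantees this.\<close>

lemma weighted_sum_weakly_pareto_optimal:
  fixes F :: "'p::finite \<Rightarrow> 'a \<Rightarrow> real"
  assumes opt: "optimal_solution (\<lambda>y. \<Sum>i\<in>UNIV. lam i * F i y) S x"
    and nonneg: "\<And>i. 0 \<le> lam i" and pos: "0 < lam k"
  shows "weakly_pareto_optimal F S x"
proof -
  have False if y: "y \<in> S" and less: "\<forall>i. F i y < F i x" for y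
  proof -
    have "(\<Sum>i\<in>UNIV. lam i * F i y) < (\<Sum>i\<in>UNIV. lam i * F i x)"
      by (rule sum_strict_mono_ex1)
        (use less nonneg pos in \<open>auto intro!: mult_left_mono mult_strict_left_mono exI[of _ k] simp: less_imp_le\<close>)
    with opt y show False by (auto simp: optimal_solution_iff not_less[symmetric])
  qed
  with opt show ?thesis by (auto simp: weakly_pareto_optimal_def optimal_solution_iff)
qed

theorem mainTheorem2:
  fixes Q :: "'p::finite \<Rightarrow> real^'n^'n"
    and c :: "'p \<Rightarrow> real^'n"
    and A :: "real^'n^'m"
    and b :: "real^'m"
    and lam :: "'p \<Rightarrow> real"
    and x :: "real^'n"
    and X :: "real^'n^'n"
  assumes Q_symmetric: "\<And>i. Q i \<in> symmetric_matrices"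
    and Q_not_psd: "\<And>i. Q i \<notin> psd_cone"
    and weights_nonneg: "\<And>i. 0 \<le> lam i"
    and weights_sum: "(\<Sum>i\<in>UNIV. lam i) = 1"
    and optimal: "optimal_solution (DNNP_obj Q c lam) (DNNP_feasible A b) (x, X)"
    and rank_one: "X = outer_product x x"
  shows "Opt (SOQP_obj Q c lam) (QP_feasible A b) = Opt (DNNP_obj Q c lam) (DNNP_feasible A b)
    \<and> optimal_solution (SOQP_obj Q c lam) (QP_feasible A b) x
    \<and> ((\<forall>i. 0 < lam i) \<longrightarrow> pareto_optimal (MOQP_obj Q c) (QP_feasible A b) x)
    \<and> ((\<forall>i. 0 \<le> lam i) \<longrightarrow> weakly_pareto_optimal (MOQP_obj Q c) (QP_feasible A b) x)"
proof (intro conjI impI)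
  have lifted: "optimal_solution (DNNP_obj Q c lam) (DNNP_feasible A b) (x, outer_product x x)"
    using optimal rank_one by simp
  have "SOQP_obj Q c lam x \<le> SOQP_obj Q c lam y" if "y \<in> QP_feasible A b" for y
    using lifted lift_feasible[OF that]
    by (metis DNNP_obj_lift optimal_solution_iff)
  moreover have "x \<in> QP_feasible A b"
    using lifted by (auto simp: optimal_solution_iff intro: DNNP_feasible_fst)
  ultimately show soqp: "optimal_solution (SOQP_obj Q c lam) (QP_feasible A b) x"
    by (simp add: optimal_solution_iff)
  show "Opt (SOQP_obj Q c lam) (QP_feasible A b) = Opt (DNNP_obj Q c lam) (DNNP_feasible A b)"
    by (simp add: Opt_eq_at_optimal_solution[OF soqp] Opt_eq_at_optimal_solution[OF lifted]
        DNNP_obj_lift)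
  have "SOQP_obj Q c lam = (\<lambda>y. \<Sum>i\<in>UNIV. lam i * MOQP_obj Q c i y)"
    by (simp add: fun_eq_iff SOQP_obj_def MOQP_obj_def)
  with soqp have scalar: "optimal_solution (\<lambda>y. \<Sum>i\<in>UNIV. lam i * MOQP_obj Q c i y)
      (QP_feasible A b) x"
    by simp
  show "pareto_optimal (MOQP_obj Q c) (QP_feasible A b) x" if "\<forall>i. 0 < lam i"
    using weighted_sum_pareto_optimal[OF scalar] that by blast
  obtain k where "lam k \<noteq> 0"
    using weights_sum by (metis sum.neutral zero_neq_one)
  then have "0 < lam k"
    using weights_nonneg[of k] by simp
  then show "weakly_pareto_optimal (MOQP_obj Q c) (QP_feasible A b) x"
    by (rule weighted_sum_weakly_pareto_optimal[OF scalar weights_nonneg])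
qed

end
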